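(* Let $m,n\ge 2$ and let $M$ be a $1$-unconditional convex body in $\mathbb{R}^m$ that contains $e_1,\dots,e_m$ in its boundary. Then there is a $\varphi\in\Phi_m$ such that $\oplus_M=+_\varphi$ as operations $\left(\mathcal{K}^n_s\right)^m\to\mathcal{K}^n_s$ and $\oplus_{M\cap[0,\infty)^m}=+_\varphi$ as operations $\left(\mathcal{K}^n_o\right)^m\to\mathcal{K}^n_o$. Moreover: (i) if $m\ge 2$, the function $\varphi$ can be chosen to be homogeneous of degree $1$; (ii) if $m=2$, $\varphi$ can be chosen as $\varphi(x_1,x_2)=\max\{x_1,x_2\}$ if $M=\operatorname{conv}\{\pm e_1,\pm e_2\}$, and of the form $\varphi(x_1,x_2)=\varphi_1(x_1)+\varphi_2(x_2)$, for some $\varphi_1,\varphi_2\in\Phi$, otherwise. If (in the latter case) $M$ is also symmetric with respect to the line $x_1=x_2$, then this holds with $\varphi_1=\varphi_2=\varphi_0$ for some $\varphi_0\in\Phi$.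
   Context: $\mathcal{K}^n_o$ is the class of compact convex subsets of $\mathbb{R}^n$ containing the origin $o$; $\mathcal{K}^n_s$ is the class of nonempty compact convex sets $K$ in $\mathbb{R}^n$ with $K=-K$. A convex body is a compact convex set with nonempty interior. A set in $\mathbb{R}^m$ is $1$-unconditional if it is symmetric with respect to each coordinate hyperplane. The support function of $K$ is $h_K(x)=\sup\{x\cdot y:y\in K\}$. $\Phi_m$ is the set of convex functions $\varphi:[0,\infty)^m\to[0,\infty)$ that are increasing (i.e. nondecreasing) in each variable and satisfy $\varphi(o)=0$ and $\varphi(e_j)=1$, $j=1,\dots,m$, where $e_1,\dots,e_m$ is the standard basis; $\Phi=\Phi_1$. Homogeneous of degree $1$ means $\varphi(rx)=r\varphi(x)$ for all $r\ge 0$. For $\varphi\in\Phi_m$ and $K_1,\dots,K_m\in\mathcal{K}^n_o$, the Orlicz sum $+_\varphi(K_1,\dots,K_m)$ is the compact convex set with support function $$h_{+_\varphi(K_1,\dots,K_m)}(x)=\inf\left\{\lambda>0:\varphi\left(\frac{h_{K_1}(x)}{\lambda},\dots,\frac{h_{K_m}(x)}{\lambda}\right)\le 1\right\},\quad x\in\mathbb{R}^n.$$ For $M\subset\mathbb{R}^m$ and sets $K_1,\dots,K_m\subset\mathbb{R}^n$, the $M$-sum is $\oplus_M(K_1,\dots,K_m)=\left\{\sum_{j=1}^m a_jx^{(j)}:x^{(j)}\in K_j,\ (a_1,\dots,a_m)\in M\right\}$. *)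

theory Defs
  imports "HOL-Analysis.Analysis"
begin

definition Ko :: "(real^'n) set set" where
  "Ko = {K. compact K \<and> convex K \<and> 0 \<in> K}"

definition Ks :: "(real^'n) set set" where
  "Ks = {K. K \<noteq> {} \<and> compact K \<and> convex K \<and> uminus ` K = K}"

definition convex_body :: "(real^'n) set \<Rightarrow> bool" where
  "convex_body K \<longleftrightarrow> compact K \<and> convex K \<and> interior K \<noteq> {}"

definition coord_reflection :: "'m \<Rightarrow> real^'m \<Rightarrow> real^'m" where
  "coord_reflection i x = (\<chi> k. if k = i then - (x $ k) else x $ k)"

definition one_unconditional :: "(real^'m) set \<Rightarrow> bool" where
  "one_unconditional M \<longleftrightarrow> (\<forall>i. coord_reflection i ` M = M)"

definition support_function :: "(real^'n) set \<Rightarrow> real^'n \<Rightarrow> real" where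
  "support_function K x = (SUP y\<in>K. x \<bullet> y)"

(* The order on an ordered Euclidean space is componentwise, so {0..} is the closed
   positive orthant, and Basis is {e_1, ..., e_m}. On real^'m this is the class Phi_m with
   m = CARD('m); on the type real, whose Basis is {1}, it is Phi = Phi_1.
   Values of a function outside {0..} are irrelevant. *)
definition Phi :: "('a::ordered_euclidean_space \<Rightarrow> real) set" where
  "Phi = {\<phi>. convex_on {0..} \<phi>
            \<and> (\<forall>x\<in>{0..}. 0 \<le> \<phi> x)
            \<and> (\<forall>x\<in>{0..}. \<forall>b\<in>Basis. \<forall>t\<ge>0. \<phi> x \<le> \<phi> (x + t *\<^sub>R b))
            \<and> \<phi> 0 = 0
            \<and> (\<forall>b\<in>Basis. \<phi> b = 1)}"

lemma Phi_real_iff: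
  "(f :: real \<Rightarrow> real) \<in> Phi \<longleftrightarrow>
     convex_on {0..} f \<and> (\<forall>x\<ge>0. 0 \<le> f x) \<and> mono_on {0..} f \<and> f 0 = 0 \<and> f 1 = 1"
proof -
  have "(\<forall>x\<ge>0. \<forall>t\<ge>0. f x \<le> f (x + t)) \<longleftrightarrow> mono_on {0..} f"
  proof
    assume *: "\<forall>x\<ge>0. \<forall>t\<ge>0. f x \<le> f (x + t)"
    show "mono_on {0..} f"
    proof (rule mono_onI)
      fix r s :: real
      assume "r \<in> {0..}" "s \<in> {0..}" "r \<le> s"
      then show "f r \<le> f s"
        using *[rule_format, of r "s - r"] by simp
    qed
  next
    assume "mono_on {0..} f"
    then show "\<forall>x\<ge>0. \<forall>t\<ge>0. f x \<le> f (x + t)"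
      by (simp add: mono_on_def)
  qed
  then show ?thesis
    by (auto simp: Phi_def)
qed

lemma Phi_vec_iff:
  "(\<phi> :: real^'m \<Rightarrow> real) \<in> Phi \<longleftrightarrow>
     convex_on {x. \<forall>i. 0 \<le> x $ i} \<phi> \<and>
     (\<forall>x. (\<forall>i. 0 \<le> x $ i) \<longrightarrow> 0 \<le> \<phi> x) \<and>
     (\<forall>x. (\<forall>i. 0 \<le> x $ i) \<longrightarrow> (\<forall>j. \<forall>t\<ge>0. \<phi> x \<le> \<phi> (x + t *\<^sub>R axis j 1))) \<and>
     \<phi> 0 = 0 \<and> (\<forall>j. \<phi> (axis j 1) = 1)"
proof -
  have orthant: "{0..} = {x :: real^'m. \<forall>i. 0 \<le> x $ i}"
    by (auto simp: less_eq_vec_def)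
  have basis: "(Basis :: (real^'m) set) = range (\<lambda>j. axis j 1)"
    by (auto simp: Basis_vec_def)
  show ?thesis
    unfolding Phi_def orthant basis by simp
qed

definition homogeneous_deg1 :: "(real^'m \<Rightarrow> real) \<Rightarrow> bool" where
  "homogeneous_deg1 \<phi> \<longleftrightarrow> (\<forall>x\<in>{0..}. \<forall>r\<ge>0. \<phi> (r *\<^sub>R x) = r * \<phi> x)"

definition orlicz_support ::
    "(real^'m \<Rightarrow> real) \<Rightarrow> ('m \<Rightarrow> (real^'n) set) \<Rightarrow> real^'n \<Rightarrow> real" where
  "orlicz_support \<phi> K x =
     Inf {r. r > 0 \<and> \<phi> (\<chi> j. support_function (K j) x / r) \<le> 1}"

definition orlicz_sum ::
    "(real^'m \<Rightarrow> real) \<Rightarrow> ('m \<Rightarrow> (real^'n) set) \<Rightarrow> (real^'n) set" where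
  "orlicz_sum \<phi> K = (THE L. L \<noteq> {} \<and> compact L \<and> convex L
                          \<and> support_function L = orlicz_support \<phi> K)"

lemma support_function_eq_imp_subset:
  fixes K L :: "(real^'n) set"
  assumes K: "K \<noteq> {}" "compact K" "convex K" and L: "compact L"
    and eq: "support_function L = support_function K"
  shows "L \<subseteq> K"
proof
  fix y assume y: "y \<in> L"
  show "y \<in> K"
  proof (rule ccontr)
    assume "y \<notin> K"
    then obtain a b where ab: "a \<bullet> y < b" "\<And>x. x \<in> K \<Longrightarrow> a \<bullet> x > b"
      using separating_hyperplane_closed_point[of K y] K compact_imp_closed by blast
    have "bdd_above ((\<lambda>z. (- a) \<bullet> z) ` L)"
      by (intro bounded_imp_bdd_above compact_imp_bounded compact_continuous_image
            continuous_intros L)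
    then have "- (a \<bullet> y) \<le> support_function L (- a)"
      unfolding support_function_def using y by (metis cSUP_upper inner_minus_left)
    moreover have "support_function K (- a) \<le> - b"
      unfolding support_function_def
      by (rule cSUP_least) (use K ab(2) in \<open>auto simp: less_imp_le\<close>)
    ultimately show False
      using ab(1) eq by simp
  qed
qed

lemma orlicz_sum_eqI:
  assumes "L \<noteq> {}" "compact L" "convex L" "support_function L = orlicz_support \<phi> K"
  shows "orlicz_sum \<phi> K = L"
  unfolding orlicz_sum_def
proof (rule the_equality)
  show "L \<noteq> {} \<and> compact L \<and> convex L \<and> support_function L = orlicz_support \<phi> K"
    using assms by simp
next
  fix L' assume "L' \<noteq> {} \<and> compact L' \<and> convex L' \<and> support_function L' = orlicz_support \<phi> K"
  then show "L' = L"
    using assms by (intro equalityI support_function_eq_imp_subset) auto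
qed

definition M_sum :: "(real^'m) set \<Rightarrow> ('m \<Rightarrow> (real^'n) set) \<Rightarrow> (real^'n) set" where
  "M_sum M K = {\<Sum>j\<in>UNIV. (a $ j) *\<^sub>R x j | a x. a \<in> M \<and> (\<forall>j. x j \<in> K j)}"

definition eq_as_operations ::
    "(real^'n) set set \<Rightarrow> (('m \<Rightarrow> (real^'n) set) \<Rightarrow> (real^'n) set)
       \<Rightarrow> (('m \<Rightarrow> (real^'n) set) \<Rightarrow> (real^'n) set) \<Rightarrow> bool" where
  "eq_as_operations C F G \<longleftrightarrow>
     (\<forall>K. (\<forall>j. K j \<in> C) \<longrightarrow> F K \<in> C \<and> G K \<in> C \<and> F K = G K)"

(* The type argument only fixes the space R^n in which the operations act. *)
definition represents :: "'n::finite itself \<Rightarrow> (real^'m \<Rightarrow> real) \<Rightarrow> (real^'m) set \<Rightarrow> bool" where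
  "represents (_ :: 'n::finite itself) \<phi> M \<longleftrightarrow>
     eq_as_operations (Ks :: (real^'n::finite) set set) (M_sum M) (orlicz_sum \<phi>) \<and>
     eq_as_operations (Ko :: (real^'n::finite) set set) (M_sum (M \<inter> {0..})) (orlicz_sum \<phi>)"

end

theory Submission
  imports Defs
begin

text \<open>For \<open>K\<^sub>j\<close> containing the origin, the support function of the sum over \<open>M \<inter> {0..}\<close> is that of
  \<open>M \<inter> {0..}\<close> evaluated at the vector of support functions of the \<open>K\<^sub>j\<close>. Hence \<open>\<phi>\<close> represents \<open>M\<close>
  whenever \<open>\<phi> \<le> 1\<close> cuts out of the orthant the polar of \<open>M \<inter> {0..}\<close>, and the support function of
  \<open>M \<inter> {0..}\<close> is a homogeneous such \<open>\<phi>\<close>. For \<open>m = 2\<close>, let \<open>(p, q)\<close> maximise the coordinate sum on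
  \<open>M\<close>, with maximum \<open>S > 1\<close>. With \<open>c = 1 / S\<close>, the line \<open>p x + q y = 1\<close> supports the polar at the
  diagonal point \<open>(c, c)\<close>. One takes \<open>\<phi>\<^sub>1\<close> affine beyond \<open>c\<close>, with slope \<open>\<alpha> = p / (S - 1)\<close>,
  and \<open>\<phi>\<^sub>2\<close> likewise, with slope \<open>\<beta> = q / (S - 1)\<close>; on \<open>{0..c}\<close> the two functions
  are then forced by the boundary of the polar, and convexity at \<open>c\<close> holds because the slopes
  are those of a supporting line.\<close>

section \<open>One-unconditional convex bodies\<close>

text \<open>The coordinates of \<open>a\<close> are replaced by those of \<open>b\<close> one at a
  time. As \<open>b $ i\<close> lies between \<open>a $ i\<close> and its negative, each new vector
  is on the segment from a vector of \<open>M\<close> to its reflection in the \<open>i\<close>-th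
  coordinate hyperplane.\<close>

lemma mem_if_abs_le_one_unconditional:
  fixes M :: "(real^'m) set"
  assumes "convex M" "one_unconditional M" "a \<in> M" and le: "\<And>k. \<bar>b $ k\<bar> \<le> \<bar>a $ k\<bar>"
  shows "b \<in> M"
proof -
  have "(\<chi> k. if k \<in> S then b $ k else a $ k) \<in> M" if "finite S" for S
    using that
  proof (induction S rule: finite_induct)
    case empty
    then show ?case using assms(3) by simp
  next
    case (insert i S)
    define v where "v = (\<chi> k. if k \<in> S then b $ k else a $ k)"
    have v: "v \<in> M" using insert.IH by (simp add: v_def)
    have w: "coord_reflection i v \<in> M"
      using assms(2) v unfolding one_unconditional_def by blast
    obtain t where t: "0 \<le> t" "t \<le> 1" "b $ i = t * a $ i + (1 - t) * - (a $ i)"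
    proof (cases "a $ i = 0")
      case True
      then show ?thesis using le[of i] that[of 0] by simp
    next
      case False
      define q where "q = b $ i / a $ i"
      have q: "b $ i = q * a $ i" using False by (simp add: q_def)
      have "\<bar>q\<bar> \<le> 1"
        using False le[of i] by (simp add: q_def divide_le_eq)
      then show ?thesis
        by (intro that[of "(1 + q) / 2"]) (auto simp: q field_simps)
    qed
    have "t *\<^sub>R v + (1 - t) *\<^sub>R coord_reflection i v \<in> M"
      using convexD[OF assms(1) v w, of t "1 - t"] t by simp
    also have "t *\<^sub>R v + (1 - t) *\<^sub>R coord_reflection i v
        = (\<chi> k. if k \<in> insert i S then b $ k else a $ k)"
      using t(3) insert.hyps
      by (auto simp: vec_eq_iff v_def coord_reflection_def algebra_simps)
    finally show ?case .
  qed
  from this[of UNIV] show ?thesis by simp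
qed

text \<open>If \<open>\<bar>a $ j\<bar> > 1\<close>, unconditionality puts the vector
  \<open>axis j \<bar>a $ j\<bar>\<close> in \<open>M\<close>. Shrinking it towards the origin,
  which is an interior point, makes \<open>axis j 1\<close> interior, so it could not be a frontier
  point.\<close>

lemma abs_component_le_1:
  fixes M :: "(real^'m) set"
  assumes M: "convex_body M" "one_unconditional M" and front: "axis j 1 \<in> frontier M"
    and a: "a \<in> M"
  shows "\<bar>a $ j\<bar> \<le> 1"
proof (rule ccontr)
  assume "\<not> ?thesis"
  then have gt: "\<bar>a $ j\<bar> > 1" by simp
  have cv: "convex M" using M(1) by (simp add: convex_body_def)
  obtain p where p: "p \<in> interior M" using M(1) by (auto simp: convex_body_def)
  \<comment> \<open>The origin is interior because it is the midpoint of the interior point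
    \<open>p\<close> and the point \<open>- p\<close> of \<open>M\<close>.\<close>
  have "- p \<in> M"
    by (rule mem_if_abs_le_one_unconditional[OF cv M(2), of p]) (use p interior_subset in auto)
  from mem_interior_convex_shrink[OF cv p this, of "1/2"]
  have "- p - (1/2) *\<^sub>R (- p - p) \<in> interior M" by simp
  moreover have "- p - (1/2) *\<^sub>R (- p - p) = 0" by (simp add: vec_eq_iff)
  ultimately have "0 \<in> interior M" by simp
  moreover have x: "axis j \<bar>a $ j\<bar> \<in> M"
    by (rule mem_if_abs_le_one_unconditional[OF cv M(2) a]) (simp add: axis_def)
  ultimately have "axis j \<bar>a $ j\<bar> - (1 - 1 / \<bar>a $ j\<bar>) *\<^sub>R (axis j \<bar>a $ j\<bar> - 0) \<in> interior M"
    using gt by (intro mem_interior_convex_shrink[OF cv]) auto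
  also have "axis j \<bar>a $ j\<bar> - (1 - 1 / \<bar>a $ j\<bar>) *\<^sub>R (axis j \<bar>a $ j\<bar> - 0) = axis j (1::real)"
    using gt by (auto simp: vec_eq_iff axis_def field_simps)
  finally show False using front by (simp add: frontier_def)
qed

section \<open>Support functions of compact sets\<close>

lemma bdd_above_inner:
  fixes L :: "('a::real_inner) set"
  assumes "compact L"
  shows "bdd_above ((\<lambda>y. x \<bullet> y) ` L)"
  by (intro bounded_imp_bdd_above compact_imp_bounded compact_continuous_image
        continuous_intros assms)

lemma support_function_le_iff:
  assumes "compact L" "L \<noteq> {}"
  shows "support_function L x \<le> r \<longleftrightarrow> (\<forall>y\<in>L. x \<bullet> y \<le> r)"
  unfolding support_function_def using assms by (intro cSUP_le_iff bdd_above_inner)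

lemma inner_le_support_function:
  assumes "compact L" "y \<in> L"
  shows "x \<bullet> y \<le> support_function L x"
  using support_function_le_iff[OF assms(1), of x] assms(2) by auto

lemma support_function_attained:
  assumes "compact L" "L \<noteq> {}"
  obtains y where "y \<in> L" "support_function L x = x \<bullet> y"
proof -
  have "continuous_on L (\<lambda>y. x \<bullet> y)" by (intro continuous_intros)
  then obtain y where y: "y \<in> L" "\<forall>z\<in>L. x \<bullet> z \<le> x \<bullet> y"
    using continuous_attains_sup[OF assms] by blast
  have "support_function L x = x \<bullet> y"
  proof (rule antisym)
    show "support_function L x \<le> x \<bullet> y"
      unfolding support_function_le_iff[OF assms] by (rule y)
  qed (rule inner_le_support_function[OF assms(1) y(1)])
  with y(1) show ?thesis by (rule that)
qed

text \<open>A point and its negative have the origin as midpoint. Through this inclusion the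
  symmetric case is reduced to sets that contain the origin.\<close>

lemma Ks_subset_Ko: "(Ks :: (real^'n) set set) \<subseteq> Ko"
proof
  fix K :: "(real^'n) set" assume K: "K \<in> Ks"
  then obtain x where x: "x \<in> K" by (auto simp: Ks_def)
  then have "- x \<in> K" using K by (auto simp: Ks_def)
  then have "(1/2) *\<^sub>R x + (1/2) *\<^sub>R (- x) \<in> K"
    using x K by (intro convexD) (auto simp: Ks_def)
  then show "K \<in> Ko" using K by (simp add: Ks_def Ko_def)
qed

section \<open>M-sums and their support functions\<close>

lemma M_sumI:
  "a \<in> M \<Longrightarrow> (\<And>j. x j \<in> K j) \<Longrightarrow> (\<Sum>j\<in>UNIV. (a $ j) *\<^sub>R x j) \<in> M_sum M K"
  by (auto simp: M_sum_def)

text \<open>A negative coefficient can pass its sign to the vector it multiplies, since each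
  \<open>K j\<close> is symmetric; the vector of absolute values of the coefficients stays in
  \<open>M\<close> by unconditionality.\<close>

lemma M_sum_orthant_Ks:
  fixes M :: "(real^'m) set" and K :: "'m \<Rightarrow> (real^'n) set"
  assumes "convex M" "one_unconditional M" and K: "\<And>j. K j \<in> Ks"
  shows "M_sum M K = M_sum (M \<inter> {0..}) K"
proof
  show "M_sum M K \<subseteq> M_sum (M \<inter> {0..}) K"
  proof
    fix y assume "y \<in> M_sum M K"
    then obtain a x where ax: "a \<in> M" "\<And>j. x j \<in> K j" and y: "y = (\<Sum>j\<in>UNIV. (a $ j) *\<^sub>R x j)"
      by (auto simp: M_sum_def)
    have "(\<chi> k. \<bar>a $ k\<bar>) \<in> M"
      by (rule mem_if_abs_le_one_unconditional[OF assms(1,2) ax(1)]) simp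
    then have "(\<chi> k. \<bar>a $ k\<bar>) \<in> M \<inter> {0..}" by (simp add: less_eq_vec_def)
    moreover have "(if a $ j < 0 then - x j else x j) \<in> K j" for j
      using ax(2)[of j] K[of j] by (auto simp: Ks_def)
    ultimately have "(\<Sum>j\<in>UNIV. ((\<chi> k. \<bar>a $ k\<bar>) $ j) *\<^sub>R (if a $ j < 0 then - x j else x j))
        \<in> M_sum (M \<inter> {0..}) K" by (rule M_sumI)
    moreover have "y = (\<Sum>j\<in>UNIV. ((\<chi> k. \<bar>a $ k\<bar>) $ j) *\<^sub>R (if a $ j < 0 then - x j else x j))"
      unfolding y by (rule sum.cong) auto
    ultimately show "y \<in> M_sum (M \<inter> {0..}) K" by simp
  qed
qed (auto simp: M_sum_def)

lemma uminus_M_sum_Ks: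
  fixes M :: "(real^'m) set" and K :: "'m \<Rightarrow> (real^'n) set"
  assumes K: "\<And>j. K j \<in> Ks"
  shows "uminus ` M_sum M K = M_sum M K"
proof -
  have *: "- y \<in> M_sum M K" if "y \<in> M_sum M K" for y
  proof -
    obtain a x where ax: "a \<in> M" "\<And>j. x j \<in> K j" and y: "y = (\<Sum>j\<in>UNIV. (a $ j) *\<^sub>R x j)"
      using \<open>y \<in> M_sum M K\<close> by (auto simp: M_sum_def)
    have "- x j \<in> K j" for j using ax(2)[of j] K[of j] by (auto simp: Ks_def)
    moreover have "- y = (\<Sum>j\<in>UNIV. (a $ j) *\<^sub>R (- x j))"
      by (simp add: y sum_negf)
    ultimately show ?thesis using M_sumI[OF ax(1), of "\<lambda>j. - x j" K] by simp
  qed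
  show ?thesis
  proof
    show "uminus ` M_sum M K \<subseteq> M_sum M K" using * by auto
    show "M_sum M K \<subseteq> uminus ` M_sum M K"
      using * by (metis image_eqI minus_minus subsetI)
  qed
qed

lemma compact_M_sum:
  fixes M :: "(real^'m) set" and K :: "'m \<Rightarrow> (real^'n) set"
  assumes "compact M" and K: "\<And>j. compact (K j)"
  shows "compact (M_sum M K)"
proof -
  \<comment> \<open>The product of the sets \<open>K j\<close> is encoded inside the Euclidean space
    \<open>(real^'n)^'m\<close>, so that closed and bounded gives compact; the sum is then a
    continuous image of \<open>M \<times> P\<close>.\<close>
  define P where "P = {x :: (real^'n)^'m. \<forall>j. x $ j \<in> K j}"
  have "\<exists>B. \<forall>x\<in>K j. norm x \<le> B" for j
    using compact_imp_bounded[OF K[of j]] by (auto simp: bounded_iff)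
  then obtain B where B: "\<And>j x. x \<in> K j \<Longrightarrow> norm x \<le> B j" by metis
  have "norm x \<le> (\<Sum>j\<in>UNIV. B j)" if "x \<in> P" for x
  proof -
    have "norm x \<le> (\<Sum>j\<in>UNIV. norm (x $ j))"
      unfolding norm_vec_def by (rule L2_set_le_sum) simp
    also have "\<dots> \<le> (\<Sum>j\<in>UNIV. B j)" using that by (intro sum_mono B) (simp add: P_def)
    finally show ?thesis .
  qed
  then have "bounded P" by (auto simp: bounded_iff)
  moreover have "closed P"
  proof -
    have "P = (\<Inter>j. (\<lambda>x. x $ j) -` K j)" by (auto simp: P_def)
    moreover have "closed ((\<lambda>x :: (real^'n)^'m. x $ j) -` K j)" for j
      by (intro closed_vimage compact_imp_closed K continuous_on_component continuous_on_id)
    ultimately show ?thesis by auto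
  qed
  ultimately have "compact (M \<times> P)"
    by (intro compact_Times assms(1)) (simp add: compact_eq_bounded_closed)
  then have "compact ((\<lambda>(a, x). \<Sum>j\<in>UNIV. (a $ j) *\<^sub>R (x $ j)) ` (M \<times> P))"
    by (rule compact_continuous_image[rotated]) (auto simp: case_prod_beta intro!: continuous_intros)
  also have "(\<lambda>(a, x). \<Sum>j\<in>UNIV. (a $ j) *\<^sub>R (x $ j)) ` (M \<times> P) = M_sum M K"
  proof
    show "M_sum M K \<subseteq> (\<lambda>(a, x). \<Sum>j\<in>UNIV. (a $ j) *\<^sub>R (x $ j)) ` (M \<times> P)"
    proof
      fix y assume "y \<in> M_sum M K"
      then obtain a x where "a \<in> M" "\<And>j. x j \<in> K j" "y = (\<Sum>j\<in>UNIV. (a $ j) *\<^sub>R x j)"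
        by (auto simp: M_sum_def)
      then show "y \<in> (\<lambda>(a, x). \<Sum>j\<in>UNIV. (a $ j) *\<^sub>R (x $ j)) ` (M \<times> P)"
        by (intro image_eqI[of _ _ "(a, \<chi> j. x j)"]) (auto simp: P_def)
    qed
  qed (auto simp: M_sum_def P_def)
  finally show ?thesis .
qed

text \<open>With nonnegative coefficients, each term \<open>u a_j x_j + v b_j w_j\<close> is
  \<open>c_j\<close> times a convex combination of \<open>x_j\<close> and \<open>w_j\<close>, where
  \<open>c = u a + v b\<close> is again in \<open>M\<close>. If \<open>c_j = 0\<close>, both parts
  vanish and any point of \<open>K j\<close> will do.\<close>

lemma convex_M_sum:
  fixes M :: "(real^'m) set" and K :: "'m \<Rightarrow> (real^'n) set"
  assumes "convex M" "M \<subseteq> {0..}" and K: "\<And>j. convex (K j)"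
  shows "convex (M_sum M K)"
proof (rule convexI)
  fix y z u v assume y: "y \<in> M_sum M K" and z: "z \<in> M_sum M K"
    and uv: "(0::real) \<le> u" "0 \<le> v" "u + v = 1"
  obtain a x where ax: "a \<in> M" "\<And>j. x j \<in> K j" and y: "y = (\<Sum>j\<in>UNIV. (a $ j) *\<^sub>R x j)"
    using y by (auto simp: M_sum_def)
  obtain b w where bw: "b \<in> M" "\<And>j. w j \<in> K j" and z: "z = (\<Sum>j\<in>UNIV. (b $ j) *\<^sub>R w j)"
    using z by (auto simp: M_sum_def)
  define c where "c = u *\<^sub>R a + v *\<^sub>R b"
  have c: "c \<in> M" unfolding c_def by (rule convexD) (use assms ax bw uv in auto)
  have nn: "0 \<le> u * a $ j" "0 \<le> v * b $ j" for j
    using assms(2) ax(1) bw(1) uv by (auto simp: less_eq_vec_def)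
  have "\<exists>q\<in>K j. (c $ j) *\<^sub>R q = (u * a $ j) *\<^sub>R x j + (v * b $ j) *\<^sub>R w j" for j
  proof (cases "c $ j = 0")
    case True
    then have "u * a $ j = 0 \<and> v * b $ j = 0"
      using nn[of j] by (simp add: c_def add_nonneg_eq_0_iff)
    then show ?thesis using True ax(2)[of j] by (intro bexI[of _ "x j"]) auto
  next
    case False
    have pos: "c $ j > 0" using False nn[of j] by (simp add: c_def)
    have "(u * a $ j / c $ j) *\<^sub>R x j + (v * b $ j / c $ j) *\<^sub>R w j \<in> K j"
      using pos nn[of j]
      by (intro convexD K ax bw) (auto simp: c_def simp flip: add_divide_distrib)
    then show ?thesis using False by (intro bexI) (auto simp: scaleR_add_right)
  qed
  then obtain q where q: "\<And>j. q j \<in> K j"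
    "\<And>j. (c $ j) *\<^sub>R q j = (u * a $ j) *\<^sub>R x j + (v * b $ j) *\<^sub>R w j" by metis
  have "u *\<^sub>R y + v *\<^sub>R z = (\<Sum>j\<in>UNIV. (c $ j) *\<^sub>R q j)"
    by (simp add: y z q(2) scaleR_sum_right sum.distrib)
  then show "u *\<^sub>R y + v *\<^sub>R z \<in> M_sum M K"
    using M_sumI[OF c q(1)] by simp
qed

text \<open>For a fixed nonnegative coefficient vector, the inner products with the summands can be
  maximised independently, each over its own \<open>K j\<close>. The form with a bound
  \<open>r\<close> matches the condition under the infimum of an Orlicz sum.\<close>

lemma support_function_M_sum_le_iff:
  fixes M :: "(real^'m) set" and K :: "'m \<Rightarrow> (real^'n) set"
  assumes M: "compact M" "M \<noteq> {}" "M \<subseteq> {0..}" and K: "\<And>j. compact (K j)" "\<And>j. K j \<noteq> {}"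
  shows "support_function (M_sum M K) x \<le> r \<longleftrightarrow>
    (\<forall>a\<in>M. (\<Sum>j\<in>UNIV. a $ j * support_function (K j) x) \<le> r)"
proof -
  have "\<exists>y\<in>K j. support_function (K j) x = x \<bullet> y" for j
    using support_function_attained[OF K] by metis
  then obtain y where y: "\<And>j. y j \<in> K j" "\<And>j. support_function (K j) x = x \<bullet> y j" by metis
  have "M_sum M K \<noteq> {}" using M(2) y(1) by (auto simp: M_sum_def)
  then have "support_function (M_sum M K) x \<le> r \<longleftrightarrow> (\<forall>y\<in>M_sum M K. x \<bullet> y \<le> r)"
    by (intro support_function_le_iff compact_M_sum assms)
  also have "\<dots> \<longleftrightarrow> (\<forall>a\<in>M. \<forall>z. (\<forall>j. z j \<in> K j) \<longrightarrow> (\<Sum>j\<in>UNIV. a $ j * (x \<bullet> z j)) \<le> r)"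
    by (fastforce simp: M_sum_def inner_sum_right)
  also have "\<dots> \<longleftrightarrow> (\<forall>a\<in>M. (\<Sum>j\<in>UNIV. a $ j * support_function (K j) x) \<le> r)"
  proof (intro ball_cong refl iffI allI impI)
    fix a assume "\<forall>z. (\<forall>j. z j \<in> K j) \<longrightarrow> (\<Sum>j\<in>UNIV. a $ j * (x \<bullet> z j)) \<le> r"
    then show "(\<Sum>j\<in>UNIV. a $ j * support_function (K j) x) \<le> r" using y by simp
  next
    fix a z assume a: "a \<in> M" and z: "\<forall>j. z j \<in> K j"
      and le: "(\<Sum>j\<in>UNIV. a $ j * support_function (K j) x) \<le> r"
    have "(\<Sum>j\<in>UNIV. a $ j * (x \<bullet> z j)) \<le> (\<Sum>j\<in>UNIV. a $ j * support_function (K j) x)"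
      using a M(3) z
      by (intro sum_mono mult_left_mono inner_le_support_function K) (auto simp: less_eq_vec_def)
    then show "(\<Sum>j\<in>UNIV. a $ j * (x \<bullet> z j)) \<le> r" using le by linarith
  qed
  finally show ?thesis .
qed

section \<open>Orlicz sums and polars\<close>

text \<open>An Orlicz sum depends on \<open>\<phi>\<close> only through its sublevel set \<open>\<phi> \<le> 1\<close> in the orthant;
  it is the \<open>M\<close>-sum as soon as that sublevel set is the polar of \<open>M\<close>.\<close>

lemma represents_if_sublevel_eq_polar:
  fixes M :: "(real^'m) set" and \<phi> :: "real^'m \<Rightarrow> real"
  assumes M: "compact M" "convex M" "M \<inter> {0..} \<noteq> {}" "one_unconditional M"
    and polar: "\<And>z. z \<in> {0..} \<Longrightarrow> \<phi> z \<le> 1 \<longleftrightarrow> (\<forall>a\<in>M \<inter> {0..}. a \<bullet> z \<le> 1)"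
  shows "represents TYPE('n::finite) \<phi> M"
proof -
  have orth: "compact (M \<inter> {0..})" "convex (M \<inter> {0..})"
  proof -
    have eq: "{0..} = (\<Inter>k. {a :: real^'m. 0 \<le> a $ k})"
      by (auto simp: less_eq_vec_def)
    have "closed {a :: real^'m. 0 \<le> a $ k}" for k
      by (intro closed_Collect_le continuous_intros)
    then have "closed {0 :: real^'m..}" unfolding eq by auto
    then show "compact (M \<inter> {0..})" using M(1) by (rule compact_Int_closed[rotated])
    have "convex {0 :: real^'m..}"
      by (auto intro!: convexI simp: less_eq_vec_def)
    then show "convex (M \<inter> {0..})" using M(2) by (rule convex_Int[rotated])
  qed
  have Ko: "M_sum (M \<inter> {0..}) K \<in> Ko \<and> orlicz_sum \<phi> K = M_sum (M \<inter> {0..}) K"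
    if K: "\<And>j. K j \<in> Ko" for K :: "'m \<Rightarrow> (real^'n) set"
  proof -
    define L where "L = M_sum (M \<inter> {0..}) K"
    have Kc: "compact (K j)" "convex (K j)" "0 \<in> K j" "K j \<noteq> {}" for j
      using K[of j] by (auto simp: Ko_def)
    have L: "compact L" "convex L"
      unfolding L_def using Kc by (intro compact_M_sum convex_M_sum orth; simp)+
    obtain a where "a \<in> M \<inter> {0..}" using M(3) by blast
    then have "0 \<in> L"
      using M_sumI[of a _ "\<lambda>_. 0" K] Kc(3) by (simp add: L_def)
    have "support_function L x = orlicz_support \<phi> K x" for x
    proof -
      have h: "support_function (K j) x \<ge> 0" for j
        using inner_le_support_function[OF Kc(1,3), of x] by simp
      have L0: "support_function L x \<ge> 0"
        using inner_le_support_function[OF L(1) \<open>0 \<in> L\<close>, of x] by simp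
      \<comment> \<open>Applying the polar condition to the vector of support values divided by
        \<open>r\<close> and clearing \<open>r\<close> gives exactly the bound for the support
        function of the M-sum.\<close>
      have "\<phi> (\<chi> j. support_function (K j) x / r) \<le> 1 \<longleftrightarrow> support_function L x \<le> r"
        if r: "r > 0" for r
      proof -
        have "\<phi> (\<chi> j. support_function (K j) x / r) \<le> 1 \<longleftrightarrow>
            (\<forall>a\<in>M \<inter> {0..}. (\<Sum>j\<in>UNIV. a $ j * support_function (K j) x) / r \<le> 1)"
          using h r by (subst polar) (auto simp: less_eq_vec_def inner_vec_def sum_divide_distrib)
        also have "\<dots> \<longleftrightarrow> support_function L x \<le> r"
          unfolding L_def using M(3) Kc r orth(1)
          by (subst support_function_M_sum_le_iff) (auto simp: divide_le_eq)
        finally show ?thesis .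
      qed
      then have "orlicz_support \<phi> K x = Inf {r. r > 0 \<and> support_function L x \<le> r}"
        unfolding orlicz_support_def by (metis (mono_tags, lifting))
      also have "\<dots> = support_function L x"
      proof (cases "support_function L x = 0")
        case True
        then have "{r. r > 0 \<and> support_function L x \<le> r} = {0<..}" by auto
        then show ?thesis using True by simp
      next
        case False
        then have "{r. r > 0 \<and> support_function L x \<le> r} = {support_function L x..}"
          using L0 by auto
        then show ?thesis by simp
      qed
      finally show ?thesis by simp
    qed
    then have "support_function L = orlicz_support \<phi> K" by blast
    then have "orlicz_sum \<phi> K = L" using L \<open>0 \<in> L\<close> by (intro orlicz_sum_eqI) auto
    then show ?thesis using L \<open>0 \<in> L\<close> by (simp add: L_def Ko_def)
  qed
  have "M_sum M K \<in> Ks \<and> orlicz_sum \<phi> K = M_sum M K"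
    if K: "\<And>j. K j \<in> Ks" for K :: "'m \<Rightarrow> (real^'n) set"
  proof -
    have "M_sum M K = M_sum (M \<inter> {0..}) K" by (intro M_sum_orthant_Ks M K)
    moreover have "M_sum (M \<inter> {0..}) K \<in> Ko \<and> orlicz_sum \<phi> K = M_sum (M \<inter> {0..}) K"
      using K Ks_subset_Ko by (intro Ko) blast
    ultimately show ?thesis
      using uminus_M_sum_Ks[of K M, OF K] by (auto simp: Ks_def Ko_def)
  qed
  then show ?thesis
    using Ko by (simp add: represents_def eq_as_operations_def)
qed

section \<open>The homogeneous choice\<close>

text \<open>The support function of \<open>P\<close> serves. It is convex and homogeneous as a
  supremum of linear functions, monotone because these have nonnegative coefficients, and normalised
  because \<open>axis j 1\<close> lies in \<open>P\<close> and no coordinate exceeds 1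
  there.\<close>

lemma homogeneous_Phi_sublevel_eq_polar:
  fixes P :: "(real^'m) set"
  assumes P: "bounded P" "P \<subseteq> {0..}" "\<And>j. axis j 1 \<in> P" "\<And>a j. a \<in> P \<Longrightarrow> a $ j \<le> 1"
  obtains \<phi> where "\<phi> \<in> Phi" "homogeneous_deg1 \<phi>"
    "\<And>z. \<phi> z \<le> 1 \<longleftrightarrow> (\<forall>a\<in>P. a \<bullet> z \<le> 1)"
proof -
  define \<phi> where "\<phi> = (\<lambda>z. SUP a\<in>P. a \<bullet> z)"
  have ne: "P \<noteq> {}" using P(3) by auto
  obtain B where B: "\<And>a. a \<in> P \<Longrightarrow> norm a \<le> B" using P(1) by (auto simp: bounded_iff)
  have bdd: "bdd_above ((\<lambda>a. a \<bullet> z) ` P)" for z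
  proof (rule bdd_aboveI2)
    fix a assume "a \<in> P"
    have "a \<bullet> z \<le> norm a * norm z" by (rule norm_cauchy_schwarz)
    also have "\<dots> \<le> B * norm z" using B[OF \<open>a \<in> P\<close>] by (rule mult_right_mono) simp
    finally show "a \<bullet> z \<le> B * norm z" .
  qed
  have le_iff: "\<phi> z \<le> r \<longleftrightarrow> (\<forall>a\<in>P. a \<bullet> z \<le> r)" for z r
    unfolding \<phi>_def by (rule cSUP_le_iff[OF ne bdd])
  have upper: "a \<bullet> z \<le> \<phi> z" if "a \<in> P" for a z
    using le_iff[of z "\<phi> z"] that by simp
  have P0: "0 \<le> a $ k" if "a \<in> P" for a k
    using that P(2) by (auto simp: less_eq_vec_def)
  have zero: "\<phi> 0 = 0" using ne by (simp add: \<phi>_def)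
  have mono: "\<phi> x \<le> \<phi> (x + t *\<^sub>R axis j 1)" if "t \<ge> 0" for x t j
    unfolding le_iff
  proof
    fix a assume a: "a \<in> P"
    have "a \<bullet> x \<le> a \<bullet> (x + t *\<^sub>R axis j 1)"
      using P0[OF a, of j] that by (simp add: inner_add_right inner_axis)
    then show "a \<bullet> x \<le> \<phi> (x + t *\<^sub>R axis j 1)" using upper[OF a] by (rule order_trans)
  qed
  have "\<phi> \<in> Phi"
    unfolding Phi_vec_iff
  proof (intro conjI allI impI zero mono)
    show "convex_on {x. \<forall>i. 0 \<le> x $ i} \<phi>"
    proof (rule convex_onI)
      show "convex {x :: real^'m. \<forall>i. 0 \<le> x $ i}" by (auto intro!: convexI)
      fix t x y assume t: "0 < t" "t < (1::real)"
      show "\<phi> ((1 - t) *\<^sub>R x + t *\<^sub>R y) \<le> (1 - t) * \<phi> x + t * \<phi> y"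
        unfolding le_iff using t upper
        by (auto simp: inner_add_right intro!: add_mono mult_left_mono)
    qed
    show "0 \<le> \<phi> x" if x: "\<forall>i. 0 \<le> x $ i" for x
      using upper[OF P(3)[of undefined], of x] x[rule_format, of undefined]
      by (simp add: inner_axis')
    show "\<phi> (axis j 1) = 1" for j
    proof (rule antisym)
      show "\<phi> (axis j 1) \<le> 1" unfolding le_iff using P(4) by (simp add: inner_axis)
      show "1 \<le> \<phi> (axis j 1)" using upper[OF P(3)[of j], of "axis j 1"] by (simp add: inner_axis_axis)
    qed
  qed
  moreover have "homogeneous_deg1 \<phi>"
    unfolding homogeneous_deg1_def
  proof (intro ballI allI impI)
    fix x and r :: real assume "0 \<le> r"
    show "\<phi> (r *\<^sub>R x) = r * \<phi> x"
    proof (cases "r = 0")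
      case False
      then have r: "r > 0" using \<open>0 \<le> r\<close> by simp
      then have "\<phi> (r *\<^sub>R x) \<le> s \<longleftrightarrow> r * \<phi> x \<le> s" for s
        using le_iff[of "r *\<^sub>R x" s] le_iff[of x "s / r"]
        by (simp add: pos_le_divide_eq mult.commute)
      then show ?thesis by (meson antisym order_refl)
    qed (simp add: zero)
  qed
  ultimately show ?thesis using that le_iff by blast
qed

section \<open>Separable functions with a given planar polar\<close>

text \<open>The constraint \<open>a x + b y \<le> 1\<close> reads \<open>\<beta> (1 - 1 / b + a / b x) \<le> \<beta> (1 - y)\<close>. Keeping only
  the constraints with \<open>a / b \<le> \<alpha> / \<beta>\<close> makes the supremum of the left-hand sides finite
  on all of \<open>{0..}\<close>, although the boundary of the polar may be vertical at \<open>x = 1\<close>.\<close>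

lemma Phi_sup_shallow_constraints:
  fixes P :: "(real \<times> real) set" and \<alpha> \<beta> :: real
  assumes pos: "\<alpha> > 0" "\<beta> > 0"
    and P: "\<And>a b. (a, b) \<in> P \<Longrightarrow> 0 \<le> a \<and> 0 \<le> b \<and> b \<le> 1" "(0, 1) \<in> P"
    and one: "\<And>a b. (a, b) \<in> P \<Longrightarrow> \<beta> * a \<le> \<alpha> * b \<Longrightarrow> \<beta> * (a + b - 1) \<le> b"
    and g: "\<alpha> + \<beta> > 1" "(\<alpha> / (\<alpha> + \<beta> - 1), \<beta> / (\<alpha> + \<beta> - 1)) \<in> P"
  obtains \<phi> where "\<phi> \<in> Phi"
    "\<And>x r. 0 \<le> x \<Longrightarrow> \<phi> x \<le> r \<longleftrightarrow>
       (\<forall>(a, b)\<in>P. b > 0 \<longrightarrow> \<beta> * a \<le> \<alpha> * b \<longrightarrow> \<beta> * (1 - 1 / b + a / b * x) \<le> r)"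
proof -
  define A where "A = {(a, b). (a, b) \<in> P \<and> b > 0 \<and> \<beta> * a \<le> \<alpha> * b}"
  define l where "l = (\<lambda>x (a, b). \<beta> * (1 - 1 / b + a / b * x))"
  define \<phi> where "\<phi> = (\<lambda>x. SUP p\<in>A. l x p)"
  \<comment> \<open>The constraint \<open>(0, 1)\<close> contributes the constant function 0, which
    bounds the supremum from below.\<close>
  have A01: "(0, 1) \<in> A" using P pos by (simp add: A_def)
  \<comment> \<open>This single bound makes the supremum finite and also forces the value at 0 to be
    at most 0.\<close>
  have lb: "l x (a, b) \<le> \<alpha> * x" if "(a, b) \<in> A" "0 \<le> x" for x a b
  proof -
    have b: "0 < b" "b \<le> 1" "0 \<le> a" "\<beta> * a \<le> \<alpha> * b" using that P by (auto simp: A_def)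
    have "\<beta> * (1 - 1 / b) \<le> 0" using b pos by (simp add: mult_nonneg_nonpos)
    moreover have "\<beta> * (a / b) * x \<le> \<alpha> * x"
      using b that(2) by (intro mult_right_mono) (auto simp: field_simps)
    ultimately show ?thesis by (simp add: l_def algebra_simps)
  qed
  have bdd: "bdd_above (l x ` A)" if "0 \<le> x" for x
    by (rule bdd_aboveI2[of _ _ "\<alpha> * x"]) (use lb that in force)
  have le_iff: "\<phi> x \<le> r \<longleftrightarrow> (\<forall>p\<in>A. l x p \<le> r)" if "0 \<le> x" for x r
    unfolding \<phi>_def by (rule cSUP_le_iff[OF _ bdd[OF that]]) (use A01 in auto)
  have upper: "l x p \<le> \<phi> x" if "p \<in> A" "0 \<le> x" for p x
    using le_iff[OF that(2), of "\<phi> x"] that by simp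
  have mono: "\<phi> x \<le> \<phi> y" if "0 \<le> x" "x \<le> y" for x y
    unfolding le_iff[OF that(1)]
  proof
    fix p assume p: "p \<in> A"
    obtain a b where ab: "p = (a, b)" by force
    have b: "0 < b" "0 \<le> a" using p P by (auto simp: A_def ab)
    have "l x p \<le> l y p"
      using b pos that by (auto simp: l_def ab intro!: mult_left_mono divide_right_mono)
    then show "l x p \<le> \<phi> y" using upper[OF p, of y] that by linarith
  qed
  have zero: "\<phi> 0 = 0"
    using le_iff[of 0 0] lb[of _ _ 0] upper[OF A01, of 0] by (force simp: l_def)
  have "\<phi> \<in> Phi"
    unfolding Phi_real_iff
  proof (intro conjI allI impI zero)
    show "convex_on {0..} \<phi>"
    proof (rule convex_onI)
      fix t x y :: real assume t: "0 < t" "t < 1" and xy: "x \<in> {0..}" "y \<in> {0..}"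
      have "0 \<le> (1 - t) *\<^sub>R x + t *\<^sub>R y" using t xy by simp
      moreover have "l ((1 - t) *\<^sub>R x + t *\<^sub>R y) p = (1 - t) * l x p + t * l y p" for p
        by (cases p) (simp add: l_def algebra_simps add_divide_distrib diff_divide_distrib)
      ultimately show "\<phi> ((1 - t) *\<^sub>R x + t *\<^sub>R y) \<le> (1 - t) * \<phi> x + t * \<phi> y"
        using t xy upper by (simp add: le_iff add_mono mult_left_mono)
    qed simp
    show "0 \<le> \<phi> x" if "0 \<le> x" for x using mono[of 0 x] that zero by simp
    show "mono_on {0..} \<phi>" using mono by (auto intro: mono_onI)
    show "\<phi> 1 = 1"
    proof (rule antisym)
      \<comment> \<open>The assumption \<open>one\<close> is this inequality with the denominator
        cleared.\<close>
      have "l 1 (a, b) \<le> 1" if "(a, b) \<in> A" for a b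
      proof -
        have b: "0 < b" "\<beta> * (a + b - 1) \<le> b" using that one by (auto simp: A_def)
        have "l 1 (a, b) = \<beta> * (a + b - 1) / b" using b by (simp add: l_def field_simps)
        then show ?thesis using b by (simp add: divide_le_eq)
      qed
      then show "\<phi> 1 \<le> 1" by (auto simp: le_iff)
      have "(\<alpha> / (\<alpha> + \<beta> - 1), \<beta> / (\<alpha> + \<beta> - 1)) \<in> A"
        using g pos by (simp add: A_def mult.commute)
      moreover have "l 1 (\<alpha> / (\<alpha> + \<beta> - 1), \<beta> / (\<alpha> + \<beta> - 1)) = 1"
      proof -
        have "l 1 (\<alpha> / t, \<beta> / t) = \<beta> - t + \<alpha>" if "t > 0" for t
          using that pos by (simp add: l_def field_simps)
        from this[of "\<alpha> + \<beta> - 1"] show ?thesis using g(1) by simp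
      qed
      ultimately show "1 \<le> \<phi> 1" using upper[of _ 1] by fastforce
    qed
  qed
  then show ?thesis
    using that[of \<phi>] le_iff by (force simp: A_def l_def)
qed

text \<open>The constraints with \<open>a / b \<le> \<alpha> / \<beta>\<close> define
  \<open>\<phi>\<^sub>1\<close>, the others, with the roles of the axes exchanged, define
  \<open>\<phi>\<^sub>2\<close>; the constraint \<open>(p, q)\<close> belongs to both. It gives each
  function an affine lower bound, valid everywhere and attained beyond the diagonal point of the
  boundary of the polar.\<close>

lemma Phi_pair_sublevel_eq_polar:
  fixes P :: "(real \<times> real) set"
  assumes P: "\<And>a b. (a, b) \<in> P \<Longrightarrow> 0 \<le> a \<and> a \<le> 1 \<and> 0 \<le> b \<and> b \<le> 1" "(1, 0) \<in> P" "(0, 1) \<in> P"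
    and pq: "(p, q) \<in> P" "p + q > 1" "\<And>a b. (a, b) \<in> P \<Longrightarrow> a + b \<le> p + q"
  obtains \<phi>\<^sub>1 \<phi>\<^sub>2 where "\<phi>\<^sub>1 \<in> Phi" "\<phi>\<^sub>2 \<in> Phi"
    "\<And>x y. 0 \<le> x \<Longrightarrow> 0 \<le> y \<Longrightarrow> \<phi>\<^sub>1 x + \<phi>\<^sub>2 y \<le> 1 \<longleftrightarrow> (\<forall>(a, b)\<in>P. a * x + b * y \<le> 1)"
proof -
  define S where "S = p + q"
  \<comment> \<open>With these slopes the affine functions
    \<open>1 - \<alpha> + \<alpha> * x\<close> and \<open>1 - \<beta> + \<beta> * y\<close> equal 1
    at 1, and their sum is at most 1 exactly when \<open>p * x + q * y \<le> 1\<close>.\<close>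
  define \<alpha> where "\<alpha> = p / (S - 1)"
  define \<beta> where "\<beta> = q / (S - 1)"
  have p: "0 < p" "0 < q" using P(1)[OF pq(1)] pq(2) by auto
  have S: "S > 1" using pq(2) by (simp add: S_def)
  have pos: "\<alpha> > 0" "\<beta> > 0" using p S by (auto simp: \<alpha>_def \<beta>_def)
  have sum: "\<alpha> + \<beta> = S / (S - 1)" by (simp add: \<alpha>_def \<beta>_def S_def add_divide_distrib)
  have g: "\<alpha> + \<beta> - 1 = 1 / (S - 1)" using S by (simp add: sum field_simps)
  have eq: "\<alpha> / (\<alpha> + \<beta> - 1) = p" "\<beta> / (\<alpha> + \<beta> - 1) = q"
    unfolding g using S by (auto simp: \<alpha>_def \<beta>_def)
  have g1: "\<alpha> + \<beta> > 1" using g S by (smt (verit) divide_pos_pos)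
  \<comment> \<open>This supplies the normalisation at 1 for both functions, with the slopes in
    either order. From \<open>a + b \<le> S\<close> comes the factor \<open>(S - 1) / S\<close>,
    which cancels against \<open>\<gamma> + \<delta>\<close>.\<close>
  have key: "\<gamma> * (a + b - 1) \<le> b" if "a + b \<le> S" "\<gamma> * a \<le> \<delta> * b" "\<gamma> > 0" "\<gamma> + \<delta> = S / (S - 1)"
    for a b \<gamma> \<delta>
  proof -
    have "(S - 1) / S * (a + b) = (a + b) - (a + b) / S" using S by (simp add: field_simps)
    moreover have "(a + b) / S \<le> 1" using that S by simp
    ultimately have "\<gamma> * (a + b - 1) \<le> \<gamma> * ((S - 1) / S * (a + b))"
      using that by (intro mult_left_mono) auto
    also have "\<dots> \<le> (S - 1) / S * ((\<gamma> + \<delta>) * b)"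
    proof -
      have "\<gamma> * (a + b) \<le> (\<gamma> + \<delta>) * b" using that(2) by (simp add: algebra_simps)
      from mult_left_mono[OF this, of "(S - 1) / S"] show ?thesis using S by (simp add: mult_ac)
    qed
    also have "\<dots> = b" using S that(4) by simp
    finally show ?thesis .
  qed
  obtain \<phi>\<^sub>1 where \<phi>1: "\<phi>\<^sub>1 \<in> Phi" "\<And>x r. 0 \<le> x \<Longrightarrow> \<phi>\<^sub>1 x \<le> r \<longleftrightarrow>
       (\<forall>(a, b)\<in>P. b > 0 \<longrightarrow> \<beta> * a \<le> \<alpha> * b \<longrightarrow> \<beta> * (1 - 1 / b + a / b * x) \<le> r)"
  proof (rule Phi_sup_shallow_constraints[of \<alpha> \<beta> P])
    show "0 \<le> a \<and> 0 \<le> b \<and> b \<le> 1" if "(a, b) \<in> P" for a b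
      using P(1)[OF that] by blast
    show "\<beta> * (a + b - 1) \<le> b" if "(a, b) \<in> P" "\<beta> * a \<le> \<alpha> * b" for a b
      using pq(3)[OF that(1)] that(2) pos(2) sum
      by (intro key[where \<delta>=\<alpha>]) (simp_all add: S_def add.commute)
    show "(\<alpha> / (\<alpha> + \<beta> - 1), \<beta> / (\<alpha> + \<beta> - 1)) \<in> P"
      unfolding eq by (rule pq)
  qed (use pos P g1 in blast)+
  obtain \<phi>\<^sub>2 where \<phi>2: "\<phi>\<^sub>2 \<in> Phi" "\<And>y r. 0 \<le> y \<Longrightarrow> \<phi>\<^sub>2 y \<le> r \<longleftrightarrow>
       (\<forall>(b, a)\<in>prod.swap ` P. a > 0 \<longrightarrow> \<alpha> * b \<le> \<beta> * a \<longrightarrow> \<alpha> * (1 - 1 / a + b / a * y) \<le> r)"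
  proof (rule Phi_sup_shallow_constraints[of \<beta> \<alpha> "prod.swap ` P"])
    show "0 \<le> a \<and> 0 \<le> b \<and> b \<le> 1" if "(a, b) \<in> prod.swap ` P" for a b
      using P(1)[of b a] that by auto
    show "(0, 1) \<in> prod.swap ` P"
      using P(2) by (rule rev_image_eqI) simp
    show "\<alpha> * (a + b - 1) \<le> b" if "(a, b) \<in> prod.swap ` P" "\<alpha> * a \<le> \<beta> * b" for a b
    proof (rule key[where \<delta>=\<beta>])
      show "a + b \<le> S" using that(1) pq(3)[of b a] by (auto simp: S_def add.commute)
    qed (use that(2) pos sum in auto)
    show "(\<beta> / (\<beta> + \<alpha> - 1), \<alpha> / (\<beta> + \<alpha> - 1)) \<in> prod.swap ` P"
      unfolding add.commute[of \<beta>] eq using pq(1) by (rule rev_image_eqI) simp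
  qed (use pos g1 in \<open>simp_all add: add.commute\<close>)
  have \<phi>2': "\<phi>\<^sub>2 y \<le> r \<longleftrightarrow>
       (\<forall>(a, b)\<in>P. a > 0 \<longrightarrow> \<alpha> * b \<le> \<beta> * a \<longrightarrow> \<alpha> * (1 - 1 / a + b / a * y) \<le> r)" if "0 \<le> y" for y r
    unfolding \<phi>2(2)[OF that] ball_simps by (simp only: case_prod_unfold fst_swap snd_swap)
  \<comment> \<open>The constraint \<open>(p, q)\<close> contributes exactly this affine function to
    the supremum.\<close>
  have lo1: "1 - \<alpha> + \<alpha> * x \<le> \<phi>\<^sub>1 x" if "0 \<le> x" for x
  proof -
    have "\<beta> * p = \<alpha> * q" by (simp add: \<alpha>_def \<beta>_def)
    then have "\<beta> * (1 - 1 / q + p / q * x) \<le> \<phi>\<^sub>1 x"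
      using \<phi>1(2)[OF that, of "\<phi>\<^sub>1 x"] pq(1) p by auto
    moreover have "\<beta> * (1 - 1 / q + p / q * x) = \<beta> - \<beta> / q + \<beta> * p / q * x"
      by (simp add: algebra_simps)
    moreover have "\<beta> / q = \<alpha> + \<beta> - 1" "\<beta> * p / q = \<alpha>"
      using p g by (simp_all add: \<alpha>_def \<beta>_def)
    ultimately show ?thesis by simp
  qed
  have lo2: "1 - \<beta> + \<beta> * y \<le> \<phi>\<^sub>2 y" if "0 \<le> y" for y
  proof -
    have "\<alpha> * q = \<beta> * p" by (simp add: \<alpha>_def \<beta>_def)
    then have "\<alpha> * (1 - 1 / p + q / p * y) \<le> \<phi>\<^sub>2 y"
      using \<phi>2(2)[OF that, of "\<phi>\<^sub>2 y"] pq(1) p by auto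
    moreover have "\<alpha> * (1 - 1 / p + q / p * y) = \<alpha> - \<alpha> / p + \<alpha> * q / p * y"
      by (simp add: algebra_simps)
    moreover have "\<alpha> / p = \<alpha> + \<beta> - 1" "\<alpha> * q / p = \<beta>"
      using p g by (simp_all add: \<alpha>_def \<beta>_def)
    ultimately show ?thesis by simp
  qed
  \<comment> \<open>Solving the constraint for \<open>y\<close> translates between the affine
    functions in the supremum and the polar.\<close>
  have cut: "1 - 1 / b + a / b * x \<le> 1 - y \<longleftrightarrow> a * x + b * y \<le> 1" if "b > 0" for a b x y :: real
  proof -
    have "1 - 1 / b + a / b * x = 1 - (1 - a * x) / b" by (simp add: diff_divide_distrib)
    then show ?thesis using pos_le_divide_eq[OF that, of y "1 - a * x"] by (auto simp: mult.commute)
  qed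
  have up1: "\<phi>\<^sub>1 x \<le> \<beta> * (1 - y)" if xy: "0 \<le> x" "\<And>a b. (a, b) \<in> P \<Longrightarrow> a * x + b * y \<le> 1" for x y
    unfolding \<phi>1(2)[OF xy(1)]
  proof clarify
    fix a b assume "(a, b) \<in> P" "0 < b"
    then have "1 - 1 / b + a / b * x \<le> 1 - y" using xy(2) cut by blast
    then show "\<beta> * (1 - 1 / b + a / b * x) \<le> \<beta> * (1 - y)"
      using pos(2) by (intro mult_left_mono) auto
  qed
  have up2: "\<phi>\<^sub>2 y \<le> \<alpha> * (1 - x)" if xy: "0 \<le> y" "\<And>a b. (a, b) \<in> P \<Longrightarrow> a * x + b * y \<le> 1" for x y
    unfolding \<phi>2'[OF xy(1)]
  proof clarify
    fix a b assume ab: "(a, b) \<in> P" "0 < a"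
    then have "1 - 1 / a + b / a * y \<le> 1 - x" using xy(2)[OF ab(1)] cut[OF ab(2)] by (simp only: add.commute)
    then show "\<alpha> * (1 - 1 / a + b / a * y) \<le> \<alpha> * (1 - x)"
      using pos(1) by (intro mult_left_mono) auto
  qed
  define c where "c = 1 / S"
  \<comment> \<open>Maximality of \<open>p + q\<close> puts the diagonal point \<open>(c, c)\<close>
    in the polar.\<close>
  have c: "a * c + b * c \<le> 1" if "(a, b) \<in> P" for a b
    using pq(3)[OF that] S by (simp add: c_def S_def flip: add_divide_distrib)
  have c0: "0 \<le> c" using S by (simp add: c_def)
  have "(\<alpha> + \<beta>) * c = \<alpha> + \<beta> - 1"
    unfolding g unfolding sum using S by (simp add: c_def)
  then have cc: "\<alpha> * c + \<beta> * c = \<alpha> + \<beta> - 1" by (simp only: distrib_right)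
  \<comment> \<open>At \<open>c\<close> every affine function in the supremum is at most
    \<open>\<beta> * (1 - c)\<close>, which by \<open>cc\<close> is the value of the affine lower
    bound there. Beyond \<open>c\<close> none of them grows faster than with slope
    \<open>\<alpha>\<close>.\<close>
  have ex1: "\<phi>\<^sub>1 x \<le> 1 - \<alpha> + \<alpha> * x" if "c \<le> x" for x
    unfolding \<phi>1(2)[OF order_trans[OF c0 that]]
  proof clarify
    fix a b assume ab: "(a, b) \<in> P" "0 < b" "\<beta> * a \<le> \<alpha> * b"
    have "\<beta> * (1 - 1 / b + a / b * c) \<le> \<beta> * (1 - c)"
      using cut[OF ab(2)] c[OF ab(1)] pos(2) by (intro mult_left_mono) auto
    moreover have "\<beta> * a / b * (x - c) \<le> \<alpha> * (x - c)"
      using that ab by (intro mult_right_mono) (auto simp: divide_le_eq)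
    moreover have "\<beta> * (1 - 1 / b + a / b * x) = \<beta> * (1 - 1 / b + a / b * c) + \<beta> * a / b * (x - c)"
      by (simp add: algebra_simps diff_divide_distrib)
    ultimately have "\<beta> * (1 - 1 / b + a / b * x) \<le> \<beta> * (1 - c) + \<alpha> * (x - c)" by linarith
    also have "\<dots> = 1 - \<alpha> + \<alpha> * x" using cc by (simp add: algebra_simps)
    finally show "\<beta> * (1 - 1 / b + a / b * x) \<le> 1 - \<alpha> + \<alpha> * x" .
  qed
  have ex2: "\<phi>\<^sub>2 y \<le> 1 - \<beta> + \<beta> * y" if "c \<le> y" for y
    unfolding \<phi>2'[OF order_trans[OF c0 that]]
  proof clarify
    fix a b assume ab: "(a, b) \<in> P" "0 < a" "\<alpha> * b \<le> \<beta> * a"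
    have "\<alpha> * (1 - 1 / a + b / a * c) \<le> \<alpha> * (1 - c)"
      using cut[OF ab(2)] c[OF ab(1)] pos(1) by (intro mult_left_mono) auto
    moreover have "\<alpha> * b / a * (y - c) \<le> \<beta> * (y - c)"
      using that ab by (intro mult_right_mono) (auto simp: divide_le_eq)
    moreover have "\<alpha> * (1 - 1 / a + b / a * y) = \<alpha> * (1 - 1 / a + b / a * c) + \<alpha> * b / a * (y - c)"
      by (simp add: algebra_simps diff_divide_distrib)
    ultimately have "\<alpha> * (1 - 1 / a + b / a * y) \<le> \<alpha> * (1 - c) + \<beta> * (y - c)" by linarith
    also have "\<dots> = 1 - \<beta> + \<beta> * y" using cc by (simp add: algebra_simps)
    finally show "\<alpha> * (1 - 1 / a + b / a * y) \<le> 1 - \<beta> + \<beta> * y" .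
  qed
  have mono: "\<phi>\<^sub>1 x \<le> \<phi>\<^sub>1 y" "\<phi>\<^sub>2 x \<le> \<phi>\<^sub>2 y" if "0 \<le> x" "x \<le> y" for x y
    using \<phi>1(1) \<phi>2(1) that by (auto simp: Phi_real_iff mono_on_def)
  have "\<phi>\<^sub>1 x + \<phi>\<^sub>2 y \<le> 1 \<longleftrightarrow> (\<forall>(a, b)\<in>P. a * x + b * y \<le> 1)" if xy: "0 \<le> x" "0 \<le> y" for x y
  proof
    assume "\<forall>(a, b)\<in>P. a * x + b * y \<le> 1"
    then have N: "\<And>a b. (a, b) \<in> P \<Longrightarrow> a * x + b * y \<le> 1" by auto
    have u: "\<phi>\<^sub>1 x \<le> \<beta> * (1 - y)" "\<phi>\<^sub>2 y \<le> \<alpha> * (1 - x)" using up1 up2 xy N by blast+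
    show "\<phi>\<^sub>1 x + \<phi>\<^sub>2 y \<le> 1"
    \<comment> \<open>If one coordinate is at least \<open>c\<close>, its function is affine there
      and the bound \<open>up1\<close> or \<open>up2\<close> controls the other. If both are below
      \<open>c\<close>, monotonicity reduces the claim to \<open>(c, c)\<close>, where the sum is at
      most 1.\<close>
    proof (cases "c \<le> y")
      case True
      then show ?thesis using ex2[of y] u(1) by (simp add: algebra_simps)
    next
      case False
      show ?thesis
      proof (cases "c \<le> x")
        case True
        then show ?thesis using ex1[of x] u(2) by (simp add: algebra_simps)
      next
        case F: False
        then have "\<phi>\<^sub>1 x \<le> \<phi>\<^sub>1 c" "\<phi>\<^sub>2 y \<le> \<phi>\<^sub>2 c" using False xy by (auto intro!: mono)
        then show ?thesis using ex1[of c] ex2[of c] cc by (simp add: algebra_simps)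
      qed
    qed
  next
    assume le: "\<phi>\<^sub>1 x + \<phi>\<^sub>2 y \<le> 1"
    show "\<forall>(a, b)\<in>P. a * x + b * y \<le> 1"
    proof clarify
      fix a b assume ab: "(a, b) \<in> P"
      then have nn: "0 \<le> a" "0 \<le> b" using P(1) by auto
      \<comment> \<open>Every nonzero constraint takes part in at least one of the two suprema. The
        affine lower bound of the other function then turns the bound on the sum into that
        constraint.\<close>
      consider "a = 0" "b = 0" | "b > 0" "\<beta> * a \<le> \<alpha> * b" | "a > 0" "\<alpha> * b \<le> \<beta> * a"
        using nn pos by (metis less_eq_real_def linear mult_pos_pos mult_zero_right not_le)
      then show "a * x + b * y \<le> 1"
      proof cases
        case 1
        then show ?thesis by simp
      next
        case 2
        have "\<phi>\<^sub>1 x \<le> \<beta> * (1 - y)" using le lo2[OF xy(2)] by (simp add: algebra_simps)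
        then have "\<beta> * (1 - 1 / b + a / b * x) \<le> \<beta> * (1 - y)"
          using \<phi>1(2)[OF xy(1)] ab 2 by blast
        then have "1 - 1 / b + a / b * x \<le> 1 - y" using pos by simp
        then show ?thesis using 2 cut by blast
      next
        case 3
        have "\<phi>\<^sub>2 y \<le> \<alpha> * (1 - x)" using le lo1[OF xy(1)] by (simp add: algebra_simps)
        then have "\<alpha> * (1 - 1 / a + b / a * y) \<le> \<alpha> * (1 - x)"
          using \<phi>2'[OF xy(2)] ab 3 by blast
        then have "1 - 1 / a + b / a * y \<le> 1 - x" using pos by simp
        then show ?thesis using 3 cut by (simp only: add.commute)
      qed
    qed
  qed
  then show ?thesis using that \<phi>1(1) \<phi>2(1) by blast
qed

section \<open>Separable functions and the cross-polytope in two coordinates\<close>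

lemma Phi_separable:
  fixes i j :: "'m::finite"
  assumes UNIV: "UNIV = {i, j}" "i \<noteq> j" and \<phi>: "\<phi>\<^sub>1 \<in> Phi" "\<phi>\<^sub>2 \<in> Phi"
  shows "(\<lambda>x :: real^'m. \<phi>\<^sub>1 (x $ i) + \<phi>\<^sub>2 (x $ j)) \<in> Phi"
proof -
  have conv: "convex_on {x :: real^'m. \<forall>i. 0 \<le> x $ i} (\<lambda>x. f (x $ k))" if "f \<in> Phi" for f k
  proof (rule convex_onI)
    show "convex {x :: real^'m. \<forall>i. 0 \<le> x $ i}" by (auto intro!: convexI)
    fix t and x y :: "real^'m" assume "0 < t" "t < (1::real)" "x \<in> {x. \<forall>i. 0 \<le> x $ i}" "y \<in> {x. \<forall>i. 0 \<le> x $ i}"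
    then show "f (((1 - t) *\<^sub>R x + t *\<^sub>R y) $ k) \<le> (1 - t) * f (x $ k) + t * f (y $ k)"
      using convex_onD[of "{0..}" f t "x $ k" "y $ k"] that by (simp add: Phi_real_iff)
  qed
  have mono: "f s \<le> f t" if "f \<in> Phi" "0 \<le> s" "s \<le> t" for f and s t :: real
    using that by (auto simp: Phi_real_iff mono_on_def)
  have 01: "f 0 = 0" "f 1 = 1" if "f \<in> Phi" for f :: "real \<Rightarrow> real"
    using that by (auto simp: Phi_real_iff)
  have nonneg: "0 \<le> f s" if "f \<in> Phi" "0 \<le> s" for f and s :: real
    using that by (auto simp: Phi_real_iff)
  show ?thesis
    unfolding Phi_vec_iff
  proof (intro conjI allI impI)
    show "convex_on {x :: real^'m. \<forall>i. 0 \<le> x $ i} (\<lambda>x. \<phi>\<^sub>1 (x $ i) + \<phi>\<^sub>2 (x $ j))"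
      by (intro convex_on_add conv \<phi>)
    show "\<phi>\<^sub>1 (axis k 1 $ i) + \<phi>\<^sub>2 (axis k 1 $ j) = 1" for k
    proof -
      have "k = i \<or> k = j" using UNIV(1) by auto
      then show ?thesis using UNIV(2) 01[OF \<phi>(1)] 01[OF \<phi>(2)] by (auto simp: axis_def)
    qed
    show "\<phi>\<^sub>1 (x $ i) + \<phi>\<^sub>2 (x $ j) \<le> \<phi>\<^sub>1 ((x + t *\<^sub>R axis k 1) $ i) + \<phi>\<^sub>2 ((x + t *\<^sub>R axis k 1) $ j)"
      if "\<forall>i. 0 \<le> x $ i" "0 \<le> t" for x :: "real^'m" and k t
      using that by (intro add_mono mono[OF \<phi>(1)] mono[OF \<phi>(2)]) (auto simp: axis_def)
  qed (use 01[OF \<phi>(1)] 01[OF \<phi>(2)] nonneg[OF \<phi>(1)] nonneg[OF \<phi>(2)] in simp_all)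
qed

text \<open>A point of the ball of the 1-norm is a convex combination of the origin and the two
  vertices with matching signs, with the absolute coordinates as weights of the vertices. The other
  inclusion is convexity of the norm.\<close>

lemma convex_hull_two_axes:
  fixes i j :: "'m::finite"
  assumes UNIV: "UNIV = {i, j}" "i \<noteq> j"
  shows "convex hull {axis i 1, - axis i 1, axis j 1, - axis j 1} = {a :: real^'m. \<bar>a $ i\<bar> + \<bar>a $ j\<bar> \<le> 1}"
    (is "?H = ?B")
proof
  have "convex ?B"
  proof (rule convexI)
    fix x y :: "real^'m" and u v :: real
    assume "x \<in> ?B" "y \<in> ?B" and uv: "0 \<le> u" "0 \<le> v" "u + v = 1"
    then have "u * (\<bar>x $ i\<bar> + \<bar>x $ j\<bar>) + v * (\<bar>y $ i\<bar> + \<bar>y $ j\<bar>) \<le> u * 1 + v * 1"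
      by (intro add_mono mult_left_mono) auto
    moreover have "\<bar>u * x $ k + v * y $ k\<bar> \<le> u * \<bar>x $ k\<bar> + v * \<bar>y $ k\<bar>" for k
      using abs_triangle_ineq[of "u * x $ k" "v * y $ k"] uv by (simp add: abs_mult)
    from this[of i] this[of j] calculation show "u *\<^sub>R x + v *\<^sub>R y \<in> ?B"
      using uv by (simp add: algebra_simps)
  qed
  then show "?H \<subseteq> ?B"
    by (intro hull_minimal) (use UNIV(2) in \<open>auto simp: axis_def\<close>)
  show "?B \<subseteq> ?H"
  proof
    fix a assume a: "a \<in> ?B"
    define e where "e = (\<lambda>k. if a $ k < 0 then - axis k 1 else (axis k 1 :: real^'m))"
    have in1: "axis i 1 \<in> ?H" "- axis i 1 \<in> ?H" by (auto intro: hull_inc)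
    then have "(1/2) *\<^sub>R axis i 1 + (1/2) *\<^sub>R - axis i 1 \<in> ?H"
      by (intro convexD convex_convex_hull) auto
    then have "0 \<in> ?H" by simp
    moreover have "e i \<in> ?H" "e j \<in> ?H" by (auto simp: e_def intro: hull_inc)
    ultimately have "convex hull {0, e i, e j} \<subseteq> ?H"
      by (intro hull_minimal convex_convex_hull) auto
    moreover have eq: "a = (1 - \<bar>a $ i\<bar> - \<bar>a $ j\<bar>) *\<^sub>R 0 + \<bar>a $ i\<bar> *\<^sub>R e i + \<bar>a $ j\<bar> *\<^sub>R e j"
    proof (unfold vec_eq_iff, rule allI)
      fix k :: 'm
      have "k = i \<or> k = j" using UNIV(1) by auto
      then show "a $ k = ((1 - \<bar>a $ i\<bar> - \<bar>a $ j\<bar>) *\<^sub>R 0 + \<bar>a $ i\<bar> *\<^sub>R e i + \<bar>a $ j\<bar> *\<^sub>R e j) $ k"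
        using UNIV(2) by (auto simp: e_def axis_def)
    qed
    have "a \<in> convex hull {0, e i, e j}"
      unfolding convex_hull_3 mem_Collect_eq
      by (intro exI conjI, rule eq) (use a in auto)
    ultimately show "a \<in> ?H" by blast
  qed
qed

section \<open>The homogeneous, planar and symmetric representations\<close>

theorem corollary5p7:
  fixes M :: "(real^'m) set"
  assumes "CARD('m) \<ge> 2" and "CARD('n::finite) \<ge> 2"
    and "convex_body M" and "one_unconditional M"
    and "\<forall>j. axis j 1 \<in> frontier M"
  shows
    "(\<exists>\<phi>\<in>Phi. represents TYPE('n) \<phi> M)
     \<and> (\<exists>\<phi>\<in>Phi. homogeneous_deg1 \<phi> \<and> represents TYPE('n) \<phi> M)
     \<and> (CARD('m) = 2 \<longrightarrow> (\<forall>i j :: 'm. i \<noteq> j \<longrightarrow>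
          (if M = convex hull {axis i 1, - axis i 1, axis j 1, - axis j 1}
           then (\<lambda>x. max (x $ i) (x $ j)) \<in> Phi
                \<and> represents TYPE('n) (\<lambda>x. max (x $ i) (x $ j)) M
           else (\<exists>\<phi>\<^sub>1\<in>Phi. \<exists>\<phi>\<^sub>2\<in>Phi.
                    (\<lambda>x. \<phi>\<^sub>1 (x $ i) + \<phi>\<^sub>2 (x $ j)) \<in> Phi
                    \<and> represents TYPE('n) (\<lambda>x. \<phi>\<^sub>1 (x $ i) + \<phi>\<^sub>2 (x $ j)) M)
                \<and> ((\<lambda>x. \<chi> k. if k = i then x $ j else x $ i) ` M = M \<longrightarrow>
                   (\<exists>\<phi>\<^sub>0\<in>Phi.
                      (\<lambda>x. \<phi>\<^sub>0 (x $ i) + \<phi>\<^sub>0 (x $ j)) \<in> Phi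
                      \<and> represents TYPE('n) (\<lambda>x. \<phi>\<^sub>0 (x $ i) + \<phi>\<^sub>0 (x $ j)) M)))))"
proof -
  have M: "compact M" "convex M" using assms(3) by (auto simp: convex_body_def)
  have ax: "axis k 1 \<in> M \<inter> {0..}" for k
    using assms(5) frontier_subset_closed[OF compact_imp_closed[OF M(1)]]
    by (auto simp: less_eq_vec_def axis_def)
  have le1: "a $ k \<le> 1" if "a \<in> M" for a k
    using abs_component_le_1[OF assms(3,4) assms(5)[rule_format] that, of k] by simp
  note rep = represents_if_sublevel_eq_polar[OF M _ assms(4), where 'n='n]
  have ne: "M \<inter> {0..} \<noteq> {}" using ax by blast
  have hom: "\<exists>\<phi>\<in>Phi. homogeneous_deg1 \<phi> \<and> represents TYPE('n) \<phi> M"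
  proof (rule homogeneous_Phi_sublevel_eq_polar[of "M \<inter> {0..}"])
    show "bounded (M \<inter> {0..})" using compact_imp_bounded[OF M(1)] by (rule bounded_subset) simp
  qed (use ax le1 ne in \<open>auto intro!: rep\<close>)
  have two: "if M = convex hull {axis i 1, - axis i 1, axis j 1, - axis j 1}
           then (\<lambda>x. max (x $ i) (x $ j)) \<in> Phi
                \<and> represents TYPE('n) (\<lambda>x. max (x $ i) (x $ j)) M
           else (\<exists>\<phi>\<^sub>1\<in>Phi. \<exists>\<phi>\<^sub>2\<in>Phi.
                    (\<lambda>x. \<phi>\<^sub>1 (x $ i) + \<phi>\<^sub>2 (x $ j)) \<in> Phi
                    \<and> represents TYPE('n) (\<lambda>x. \<phi>\<^sub>1 (x $ i) + \<phi>\<^sub>2 (x $ j)) M)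
                \<and> ((\<lambda>x. \<chi> k. if k = i then x $ j else x $ i) ` M = M \<longrightarrow>
                   (\<exists>\<phi>\<^sub>0\<in>Phi.
                      (\<lambda>x. \<phi>\<^sub>0 (x $ i) + \<phi>\<^sub>0 (x $ j)) \<in> Phi
                      \<and> represents TYPE('n) (\<lambda>x. \<phi>\<^sub>0 (x $ i) + \<phi>\<^sub>0 (x $ j)) M))"
    if card: "CARD('m) = 2" and ij: "i \<noteq> j" for i j :: 'm
  proof -
    have UNIV: "UNIV = {i, j}"
      using card_subset_eq[of UNIV "{i, j}"] card ij by simp
    have cases_ij: "k = i \<or> k = j" for k using UNIV by auto
    have inner: "a \<bullet> z = a $ i * z $ i + a $ j * z $ j" for a z :: "real^'m"
      using ij by (simp add: inner_vec_def UNIV)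
    show ?thesis
    proof (cases "M = convex hull {axis i 1, - axis i 1, axis j 1, - axis j 1}")
      case True
      then have M_eq: "M = {a. \<bar>a $ i\<bar> + \<bar>a $ j\<bar> \<le> 1}"
        using convex_hull_two_axes[OF UNIV ij] by simp
      have "(\<lambda>x :: real^'m. max (x $ i) (x $ j)) \<in> Phi"
        unfolding Phi_vec_iff
      proof (intro conjI allI impI)
        show "convex_on {x :: real^'m. \<forall>i. 0 \<le> x $ i} (\<lambda>x. max (x $ i) (x $ j))"
        proof (rule convex_onI)
          show "convex {x :: real^'m. \<forall>i. 0 \<le> x $ i}" by (auto intro!: convexI)
          fix t and x y :: "real^'m" assume t: "0 < t" "t < (1::real)"
          show "max (((1 - t) *\<^sub>R x + t *\<^sub>R y) $ i) (((1 - t) *\<^sub>R x + t *\<^sub>R y) $ j)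
            \<le> (1 - t) * max (x $ i) (x $ j) + t * max (y $ i) (y $ j)"
            using t by (auto intro!: add_mono mult_left_mono)
        qed
        show "max (axis k 1 $ i) (axis k 1 $ j) = (1::real)" for k
          using cases_ij[of k] ij by (auto simp: axis_def)
      qed (auto simp: axis_def max_def le_max_iff_disj)
      \<comment> \<open>The polar of the 1-norm ball is the ball of the maximum norm.\<close>
      moreover have "represents TYPE('n) (\<lambda>x. max (x $ i) (x $ j)) M"
      proof (rule rep[OF ne])
        fix z :: "real^'m" assume "z \<in> {0..}"
        show "max (z $ i) (z $ j) \<le> 1 \<longleftrightarrow> (\<forall>a\<in>M \<inter> {0..}. a \<bullet> z \<le> 1)"
        proof
          assume z: "max (z $ i) (z $ j) \<le> 1"
          show "\<forall>a\<in>M \<inter> {0..}. a \<bullet> z \<le> 1"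
          proof
            fix a assume "a \<in> M \<inter> {0..}"
            then have a: "0 \<le> a $ i" "0 \<le> a $ j" "a $ i + a $ j \<le> 1"
              by (auto simp: M_eq less_eq_vec_def)
            have "a \<bullet> z \<le> a $ i * 1 + a $ j * 1"
              unfolding inner using a z by (intro add_mono mult_left_mono) auto
            then show "a \<bullet> z \<le> 1" using a by simp
          qed
        next
          assume "\<forall>a\<in>M \<inter> {0..}. a \<bullet> z \<le> 1"
          then have "axis k 1 \<bullet> z \<le> 1" for k using ax by blast
          then show "max (z $ i) (z $ j) \<le> 1" by (simp add: inner_axis')
        qed
      qed
      ultimately show ?thesis using True by simp
    next
      case False
      define P where "P = (\<lambda>a. (a $ i, a $ j)) ` (M \<inter> {0..})"
      have "M \<noteq> {}" using ne by blast
      moreover have "continuous_on M (\<lambda>a. a $ i + a $ j)" by (intro continuous_intros)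
      \<comment> \<open>The maximiser of the coordinate sum plays the part of
        \<open>(p, q)\<close>.\<close>
      ultimately obtain s where s: "s \<in> M" "\<And>a. a \<in> M \<Longrightarrow> a $ i + a $ j \<le> s $ i + s $ j"
        using continuous_attains_sup[OF M(1)] by blast
      \<comment> \<open>\<open>M\<close> always contains the cross-polytope, so being different from
        it forces a point outside the 1-norm ball.\<close>
      have "\<exists>a\<in>M. \<bar>a $ i\<bar> + \<bar>a $ j\<bar> > 1"
      proof (rule ccontr)
        assume "\<not> ?thesis"
        then have "M \<subseteq> {a. \<bar>a $ i\<bar> + \<bar>a $ j\<bar> \<le> 1}" by force
        moreover have "convex hull {axis i 1, - axis i 1, axis j 1, - axis j 1} \<subseteq> M"
        proof (rule hull_minimal)
          have "- axis k 1 \<in> M" for k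
            by (rule mem_if_abs_le_one_unconditional[OF M(2) assms(4), of "axis k 1"]) (use ax in auto)
          then show "{axis i 1, - axis i 1, axis j 1, - axis j 1} \<subseteq> M" using ax by auto
        qed (rule M)
        ultimately show False using False convex_hull_two_axes[OF UNIV ij] by simp
      qed
      then obtain a where a: "a \<in> M" "\<bar>a $ i\<bar> + \<bar>a $ j\<bar> > 1" by blast
      have "(\<chi> k. \<bar>a $ k\<bar>) \<in> M"
        by (rule mem_if_abs_le_one_unconditional[OF M(2) assms(4) a(1)]) simp
      from s(2)[OF this] have s1: "s $ i + s $ j > 1" using a(2) by simp
      \<comment> \<open>Two coordinates of at most 1 whose sum exceeds 1 are both positive.\<close>
      have s0: "0 \<le> s $ k" for k
        using s1 le1[OF s(1), of i] le1[OF s(1), of j] cases_ij[of k] by auto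
      obtain \<phi>\<^sub>1 \<phi>\<^sub>2 where \<phi>: "\<phi>\<^sub>1 \<in> Phi" "\<phi>\<^sub>2 \<in> Phi"
        and P: "\<And>x y. 0 \<le> x \<Longrightarrow> 0 \<le> y \<Longrightarrow> \<phi>\<^sub>1 x + \<phi>\<^sub>2 y \<le> 1 \<longleftrightarrow> (\<forall>(a, b)\<in>P. a * x + b * y \<le> 1)"
      proof (rule Phi_pair_sublevel_eq_polar[of P "s $ i" "s $ j"])
        show "0 \<le> a \<and> a \<le> 1 \<and> 0 \<le> b \<and> b \<le> 1" if "(a, b) \<in> P" for a b
          using that le1 by (auto simp: P_def less_eq_vec_def)
        show "(1, 0) \<in> P"
          unfolding P_def using ax[of i] ij by (intro image_eqI[of _ _ "axis i 1"]) (auto simp: axis_def)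
        show "(0, 1) \<in> P"
          unfolding P_def using ax[of j] ij by (intro image_eqI[of _ _ "axis j 1"]) (auto simp: axis_def)
        show "(s $ i, s $ j) \<in> P"
          unfolding P_def using s s0 by (intro image_eqI[of _ _ s]) (auto simp: less_eq_vec_def)
      qed (use s s1 in \<open>auto simp: P_def\<close>)
      have polar: "\<phi>\<^sub>1 (z $ i) + \<phi>\<^sub>2 (z $ j) \<le> 1 \<longleftrightarrow> (\<forall>a\<in>M \<inter> {0..}. a \<bullet> z \<le> 1)" if "z \<in> {0..}" for z
      proof -
        have "0 \<le> z $ i" "0 \<le> z $ j" using that by (auto simp: less_eq_vec_def)
        then have "\<phi>\<^sub>1 (z $ i) + \<phi>\<^sub>2 (z $ j) \<le> 1 \<longleftrightarrow> (\<forall>(a, b)\<in>P. a * z $ i + b * z $ j \<le> 1)"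
          by (rule P)
        then show ?thesis by (simp only: P_def inner ball_simps prod.case)
      qed
      have gen: "(\<lambda>x. \<phi>\<^sub>1 (x $ i) + \<phi>\<^sub>2 (x $ j)) \<in> Phi
                    \<and> represents TYPE('n) (\<lambda>x. \<phi>\<^sub>1 (x $ i) + \<phi>\<^sub>2 (x $ j)) M"
        by (rule conjI[OF Phi_separable[OF UNIV ij \<phi>] rep[OF ne polar]])
      moreover have "\<exists>\<phi>\<^sub>0\<in>Phi. (\<lambda>x. \<phi>\<^sub>0 (x $ i) + \<phi>\<^sub>0 (x $ j)) \<in> Phi
                      \<and> represents TYPE('n) (\<lambda>x. \<phi>\<^sub>0 (x $ i) + \<phi>\<^sub>0 (x $ j)) M"
        if sym: "(\<lambda>x. \<chi> k. if k = i then x $ j else x $ i) ` M = M"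
      proof -
        define sw where "sw = (\<lambda>x :: real^'m. (\<chi> k. if k = i then x $ j else x $ i) :: real^'m)"
        \<comment> \<open>Exchanging the coordinates preserves \<open>M\<close>, so
          \<open>\<phi>\<^sub>1\<close> and \<open>\<phi>\<^sub>2\<close> may trade places without
          changing the sublevel set; averaging the two arrangements gives a symmetric one.\<close>
        define \<phi>\<^sub>0 where "\<phi>\<^sub>0 = (\<lambda>x. (1/2) * \<phi>\<^sub>1 x + (1/2) * \<phi>\<^sub>2 x)"
        have \<phi>0: "\<phi>\<^sub>0 \<in> Phi"
          unfolding Phi_real_iff
        proof (intro conjI allI impI)
          show "convex_on {0..} \<phi>\<^sub>0"
            using \<phi> unfolding \<phi>\<^sub>0_def Phi_real_iff by (intro convex_on_add convex_on_cmul) auto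
          show "mono_on {0..} \<phi>\<^sub>0"
          proof (rule mono_onI)
            fix s t :: real assume "s \<in> {0..}" "t \<in> {0..}" "s \<le> t"
            then have "\<phi>\<^sub>1 s \<le> \<phi>\<^sub>1 t" "\<phi>\<^sub>2 s \<le> \<phi>\<^sub>2 t"
              using \<phi> unfolding Phi_real_iff mono_on_def by blast+
            then show "\<phi>\<^sub>0 s \<le> \<phi>\<^sub>0 t" by (simp add: \<phi>\<^sub>0_def)
          qed
        qed (use \<phi> in \<open>simp_all add: \<phi>\<^sub>0_def Phi_real_iff\<close>)
        have "\<phi>\<^sub>0 (z $ i) + \<phi>\<^sub>0 (z $ j) \<le> 1 \<longleftrightarrow> (\<forall>a\<in>M \<inter> {0..}. a \<bullet> z \<le> 1)" if z: "z \<in> {0..}" for z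
        proof -
          have sw: "sw a \<in> M \<inter> {0..}" if "a \<in> M \<inter> {0..}" for a
          proof -
            have "sw a \<in> M" using that sym unfolding sw_def by blast
            then show ?thesis using that by (simp add: sw_def less_eq_vec_def)
          qed
          have inner_sw: "sw a \<bullet> z = a \<bullet> sw z" "sw (sw a) = a" for a
          proof -
            have "sw (sw a) $ k = a $ k" for k using cases_ij[of k] ij by (auto simp: sw_def)
            then show "sw (sw a) = a" by (simp add: vec_eq_iff)
          qed (use ij in \<open>simp add: inner sw_def\<close>)
          \<comment> \<open>The exchange \<open>sw\<close> is a self-adjoint involution that
            preserves \<open>M \<inter> {0..}\<close>, so \<open>z\<close> and \<open>sw z\<close>
            lie in the polar together.\<close>
          have "(\<forall>a\<in>M \<inter> {0..}. a \<bullet> z \<le> 1) \<longleftrightarrow> (\<forall>a\<in>M \<inter> {0..}. a \<bullet> sw z \<le> 1)"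
            using sw inner_sw by metis
          moreover have "sw z \<in> {0..}" "sw z $ i = z $ j" "sw z $ j = z $ i"
            using z ij by (auto simp: sw_def less_eq_vec_def)
          ultimately have "\<phi>\<^sub>1 (z $ j) + \<phi>\<^sub>2 (z $ i) \<le> 1 \<longleftrightarrow> (\<forall>a\<in>M \<inter> {0..}. a \<bullet> z \<le> 1)"
            using polar[of "sw z"] by simp
          \<comment> \<open>Two sums that are at most 1 under the same condition \<open>B\<close>
            have a mean that is at most 1 under exactly that condition: otherwise both exceed
            1.\<close>
          moreover have "1/2 * p + 1/2 * q + (1/2 * r + 1/2 * s) \<le> 1 \<longleftrightarrow> B"
            if "p + s \<le> 1 \<longleftrightarrow> B" "r + q \<le> 1 \<longleftrightarrow> B" for p q r s :: real and B
            using that by (cases B) auto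
          ultimately show ?thesis
            using polar[OF z] unfolding \<phi>\<^sub>0_def by blast
        qed
        then show ?thesis
          by (intro bexI[OF _ \<phi>0] conjI Phi_separable[OF UNIV ij \<phi>0 \<phi>0] rep[OF ne])
      qed
      ultimately show ?thesis using False \<phi>
        by (simp only: if_False) blast
    qed
  qed
  show ?thesis using hom two by blast
qed

end
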